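(* Let $G$ and $H$ be simple graphs with $V(G)=V(H)=[n]=\{1,\ldots,n\}$, with adjacency matrices $A(G)$ and $A(H)$, and let $\varphi:[n]\to[n]$ be a bijection. Then $\varphi$ is an isomorphism of $G$ onto $H$ (so in particular $G\simeq H$) if and only if for all $x=(x_1,\ldots,x_n)\in\mathbb{R}^n$ $$\det\bigl(A(G)+\mathrm{diag}(x_1,\ldots,x_n)\bigr)=\det\bigl(A(H)+\mathrm{diag}(y_1,\ldots,y_n)\bigr),$$ where $y\in\mathbb{R}^n$ is defined by $y_{\varphi(i)}=x_i$ for $i=1,\ldots,n$ (i.e. the variable attached to vertex $\varphi(i)$ of $H$ is the variable $x_i$ attached to vertex $i$ of $G$).
   Context: The adjacency matrix $A(G)$ of a simple graph $G$ on $[n]$ is the $n\times n$ $0/1$ matrix with $(A(G))_{ij}=1$ iff $\{i,j\}\in E(G)$ (zero diagonal). An isomorphism of $G$ onto $H$ is a bijection $\varphi:V(G)\to V(H)$ with $\{i,j\}\in E(G)\iff\{\varphi(i),\varphi(j)\}\in E(H)$ for all $i,j$. The paper calls $\eta_G(x_1,\ldots,x_n)=\det(A(G)+\mathrm{diag}(x_1,\ldots,x_n))$ the modified characteristic polynomial of $G$. *)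

theory Defs
  imports "HOL-Analysis.Analysis" "Graph_Theory.Pair_Digraph" "Graph_Theory.Digraph_Isomorphism"
begin

text \<open>
  A simple graph is a \<^locale>\<open>pair_graph\<close>: a finite, loop-free, symmetric digraph without
  parallel arcs. The undirected edge {i, j} is the pair of arcs (i, j) and (j, i), so
  {i, j} being an edge of G reads \<open>(i, j) \<in> parcs G\<close>.

  The vertex set [n] is the universe of a finite index type \<open>'n\<close> with \<open>n = CARD('n)\<close>.
\<close>

definition adjacency_matrix :: "('n::finite) pair_pre_digraph \<Rightarrow> real^'n^'n" where
  "adjacency_matrix G = (\<chi> i j. if (i, j) \<in> parcs G then 1 else 0)"

definition diag :: "real^'n \<Rightarrow> real^'n^'n" where
  "diag x = (\<chi> i j. if i = j then x $ i else 0)"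

definition graph_isomorphism ::
    "('a \<Rightarrow> 'b) \<Rightarrow> 'a pair_pre_digraph \<Rightarrow> 'b pair_pre_digraph \<Rightarrow> bool" where
  "graph_isomorphism \<phi> G H \<longleftrightarrow>
     bij_betw \<phi> (pverts G) (pverts H) \<and>
     (\<forall>i\<in>pverts G. \<forall>j\<in>pverts G. (i, j) \<in> parcs G \<longleftrightarrow> (\<phi> i, \<phi> j) \<in> parcs H)"

text \<open>
  On simple graphs, the library's \<^const>\<open>digraph_iso\<close>, whose witnesses map vertices and arcs
  separately, is the existence of such a bijection of the vertices.
\<close>

lemma digraph_iso_iff_graph_isomorphism:
  assumes "pair_graph G" "pair_graph H"
  shows "digraph_iso (with_proj G) (with_proj H) \<longleftrightarrow> (\<exists>\<phi>. graph_isomorphism \<phi> G H)"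
proof
  interpret G: pair_graph G by fact
  assume "digraph_iso (with_proj G) (with_proj H)"
  then obtain f where f: "pre_digraph.digraph_isomorphism (with_proj G) f"
    and H: "with_proj H = app_iso f (with_proj G)"
    unfolding digraph_iso_def by blast
  let ?\<phi> = "iso_verts f"
  have inj: "inj_on ?\<phi> (pverts G)" and ends: "\<And>a. a \<in> parcs G \<Longrightarrow>
      ?\<phi> (fst a) = iso_tail f (iso_arcs f a) \<and> ?\<phi> (snd a) = iso_head f (iso_arcs f a)"
    using f unfolding pre_digraph.digraph_isomorphism_def by auto
  have HV: "pverts H = ?\<phi> ` pverts G" and HA: "parcs H = iso_arcs f ` parcs G"
    and HT: "iso_tail f = fst" and HH: "iso_head f = snd"
    using arg_cong[OF H, of verts] arg_cong[OF H, of arcs]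
      arg_cong[OF H, of tail] arg_cong[OF H, of head] by simp_all
  have arc: "iso_arcs f a = (?\<phi> (fst a), ?\<phi> (snd a))" if "a \<in> parcs G" for a
    using ends[OF that] HT HH by (simp add: prod_eq_iff)
  have "(i, j) \<in> parcs G \<longleftrightarrow> (?\<phi> i, ?\<phi> j) \<in> parcs H" if "i \<in> pverts G" "j \<in> pverts G" for i j
  proof
    assume "(i, j) \<in> parcs G"
    then show "(?\<phi> i, ?\<phi> j) \<in> parcs H"
      unfolding HA using arc[of "(i, j)"] by force
  next
    assume "(?\<phi> i, ?\<phi> j) \<in> parcs H"
    then obtain k l where kl: "(k, l) \<in> parcs G" "(?\<phi> i, ?\<phi> j) = iso_arcs f (k, l)"
      unfolding HA by force
    then have "?\<phi> i = ?\<phi> k" "?\<phi> j = ?\<phi> l" "k \<in> pverts G" "l \<in> pverts G"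
      using arc[OF kl(1)] G.wellformed' by auto
    with inj that kl(1) show "(i, j) \<in> parcs G"
      by (metis inj_onD)
  qed
  then have "graph_isomorphism ?\<phi> G H"
    unfolding graph_isomorphism_def bij_betw_def using inj HV by blast
  then show "\<exists>\<phi>. graph_isomorphism \<phi> G H" by (rule exI[of _ ?\<phi>])
next
  interpret G: pair_graph G by fact
  interpret H: pair_graph H by fact
  assume "\<exists>\<phi>. graph_isomorphism \<phi> G H"
  then obtain \<phi> where inj: "inj_on \<phi> (pverts G)" and im: "\<phi> ` pverts G = pverts H"
    and iff: "\<And>i j. i \<in> pverts G \<Longrightarrow> j \<in> pverts G \<Longrightarrow>
      (i, j) \<in> parcs G \<longleftrightarrow> (\<phi> i, \<phi> j) \<in> parcs H"
    unfolding graph_isomorphism_def bij_betw_def by blast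
  let ?f = "\<lparr>iso_verts = \<phi>, iso_arcs = map_prod \<phi> \<phi>, iso_head = snd, iso_tail = fst\<rparr>"
  have arcs: "parcs H = map_prod \<phi> \<phi> ` parcs G"
  proof (intro set_eqI iffI)
    fix a assume a: "a \<in> parcs H"
    then have "fst a \<in> \<phi> ` pverts G" "snd a \<in> \<phi> ` pverts G"
      using H.arc_fst_in_verts H.arc_snd_in_verts im by auto
    then obtain i j where ij: "i \<in> pverts G" "j \<in> pverts G" "a = (\<phi> i, \<phi> j)"
      by (metis imageE prod.collapse)
    then have "(i, j) \<in> parcs G" using a iff[of i j] by blast
    then show "a \<in> map_prod \<phi> \<phi> ` parcs G" using ij(3) by (metis image_eqI map_prod_simp)
  next
    fix a assume "a \<in> map_prod \<phi> \<phi> ` parcs G"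
    then obtain i j where "(i, j) \<in> parcs G" "a = (\<phi> i, \<phi> j)" by auto
    then show "a \<in> parcs H" using iff[of i j] G.wellformed' by blast
  qed
  have "inj_on (map_prod \<phi> \<phi>) (parcs G)"
    by (rule inj_on_subset[OF map_prod_inj_on[OF inj inj]]) (auto dest: G.wellformed')
  then have "pre_digraph.digraph_isomorphism (with_proj G) ?f"
    unfolding pre_digraph.digraph_isomorphism_def
    using inj G.wf_digraph by (auto simp: wf_digraph_wp_iff G.pair_wf_digraph)
  moreover have "with_proj H = app_iso ?f (with_proj G)"
    by (simp add: app_iso_def with_proj_def im arcs)
  ultimately show "digraph_iso (with_proj G) (with_proj H)"
    unfolding digraph_iso_def by blast
qed

end

theory Submission
  imports Defs
begin

text \<open>
  The coefficient of \<open>\<Prod>k\<notin>{i, j}. x k\<close> in \<open>det (A + diag x)\<close> is the principal minor of A on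
  the rows and columns i, j, which for an adjacency matrix is \<open>- (A i j)\<^sup>2\<close>. We extract it as a
  limit: put \<open>x i = x j = 0\<close> and \<open>x k = 1 / s\<close> for the other k, multiply the rows other than i, j
  by s, and let s tend to 0.
\<close>

text \<open>Permuting the rows and permuting the columns each contribute a factor
  \<open>sign p\<close>, and the two signs cancel. This allows the vertices of \<open>H\<close> to
  be relabelled along \<open>\<phi>\<close>.\<close>

lemma det_permute_rows_columns:
  fixes M :: "'a::comm_ring_1^'n^'n" and p :: "'n \<Rightarrow> 'n"
  assumes "bij p"
  shows "det (\<chi> i j. M $ p i $ p j) = det M"
proof -
  have p: "p permutes UNIV"
    using assms by (intro bij_imp_permutes) auto
  have "det (\<chi> i j. M $ p i $ p j) = of_int (sign p) * det (\<chi> i. M $ p i)"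
    using det_permute_columns[OF p, of "\<chi> i. M $ p i"] by simp
  also have "\<dots> = of_int (sign p) * (of_int (sign p) * det M)"
    by (simp add: det_permute_rows[OF p])
  also have "\<dots> = det M"
    by (simp add: sign_def)
  finally show ?thesis .
qed

text \<open>In the Leibniz expansion a unit row \<open>k\<close> kills every permutation that moves
  \<open>k\<close>. Only permutations supported on \<open>{i, j}\<close> survive: the identity and
  the transposition.\<close>

lemma det_unit_rows_outside_pair:
  fixes A :: "'a::comm_ring_1^'n^'n"
  assumes "i \<noteq> j"
  shows "det (\<chi> k l. if k \<in> {i, j} then A $ k $ l else if k = l then 1 else 0)
       = A $ i $ i * A $ j $ j - A $ i $ j * A $ j $ i"
    (is "det ?M = _")
proof -
  let ?f = "\<lambda>p. of_int (sign p) * (\<Prod>k\<in>UNIV. ?M $ k $ p k)"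
  have outside: "?f p = 0" if "p permutes UNIV" "p \<notin> {id, Transposition.transpose i j}" for p
  proof -
    have "\<not> p permutes {i, j}"
      using that(2) by (simp add: permutes_doubleton_iff)
    with that(1) obtain k where "k \<notin> {i, j}" "p k \<noteq> k"
      using permutes_superset[of p UNIV "{i, j}"] by blast
    then have "?M $ k $ p k = 0" by auto
    then have "(\<Prod>k\<in>UNIV. ?M $ k $ p k) = 0"
      by (rule prod_zero[OF finite bexI[OF _ UNIV_I]])
    then show ?thesis by simp
  qed
  have pair: "(\<Prod>k\<in>UNIV. ?M $ k $ p k) = A $ i $ p i * A $ j $ p j"
    if "p \<in> {id, Transposition.transpose i j}" for p
  proof -
    have "(\<Prod>k\<in>UNIV. ?M $ k $ p k) = (\<Prod>k\<in>{i, j}. ?M $ k $ p k)"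
      using that
      by (intro prod.mono_neutral_right) (auto simp: Transposition.transpose_def split: if_splits)
    then show ?thesis using assms by simp
  qed
  have ne: "id \<noteq> Transposition.transpose i j"
    using assms by (metis id_apply transpose_apply_first)
  have "det ?M = sum ?f {p. p permutes UNIV}"
    by (simp add: det_def)
  also have "\<dots> = sum ?f {id, Transposition.transpose i j}"
    using outside by (intro sum.mono_neutral_right) (auto simp: finite_permutations permutes_swap_id)
  also have "\<dots> = (\<Sum>p\<in>{id, Transposition.transpose i j}. of_int (sign p) * (A $ i $ p i * A $ j $ p j))"
    by (intro sum.cong refl) (simp only: pair)
  also have "\<dots> = A $ i $ i * A $ j $ j - A $ i $ j * A $ j $ i"
    using ne assms by (simp add: sign_swap_id)
  finally show ?thesis .
qed

lemma principal_minor_eq_if_det_add_diag_eq: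
  fixes A B :: "real^'n^'n"
  assumes eq: "\<And>x. det (A + diag x) = det (B + diag x)" and ij: "i \<noteq> j"
  shows "A $ i $ i * A $ j $ j - A $ i $ j * A $ j $ i
       = B $ i $ i * B $ j $ j - B $ i $ j * B $ j $ i"
proof -
  \<comment> \<open>The rescaled matrix with the product \<open>s * (1 / s)\<close> already
    cancelled to 1 on the diagonal, so that it also makes sense at \<open>s = 0\<close>.\<close>
  define N :: "real^'n^'n \<Rightarrow> real \<Rightarrow> real^'n^'n" where
    "N C s = (\<chi> k l. if k \<in> {i, j} then C $ k $ l
                     else s * C $ k $ l + (if k = l then 1 else 0))" for C s
  have N: "N C s = (\<chi> k. (if k \<in> {i, j} then 1 else s) *s
      (C + diag (\<chi> k. if k \<in> {i, j} then 0 else 1 / s)) $ k)" if "s \<noteq> 0" for C s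
    using that by (auto simp: N_def vec_eq_iff diag_def algebra_simps)
  \<comment> \<open>The row factors pulled out of the determinant do not depend on \<open>C\<close>,
    and what remains is \<open>det (C + diag x)\<close> with the same \<open>x\<close> for
    \<open>A\<close> and \<open>B\<close>.\<close>
  have det_N: "det (N A s) = det (N B s)" if "s \<noteq> 0" for s
    unfolding N[OF that] det_rows_mul by (simp only: vec_lambda_eta eq)
  have lim: "((\<lambda>s. det (N C s)) \<longlongrightarrow> det (N C 0)) (at 0)" for C
  proof -
    have cont: "isCont (\<lambda>s. N C s $ k $ l) 0" for k l
      by (cases "k \<in> {i, j}") (auto simp: N_def intro!: continuous_intros)
    then have "isCont (\<lambda>s. det (N C s)) 0"
      unfolding det_def by (intro continuous_sum continuous_mult continuous_const continuous_prod cont)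
    then show ?thesis by (simp add: isCont_def)
  qed
  \<comment> \<open>\<open>det_N\<close> excludes \<open>s = 0\<close>, so the values at 0 are
    compared through uniqueness of the limit.\<close>
  have "((\<lambda>s. det (N A s)) \<longlongrightarrow> det (N B 0)) (at 0)"
    by (rule Lim_transform_eventually[OF lim[of B]])
      (auto simp: eventually_at_filter det_N)
  with lim[of A] have "det (N A 0) = det (N B 0)"
    by (rule LIM_unique)
  moreover have "N C 0 = (\<chi> k l. if k \<in> {i, j} then C $ k $ l else if k = l then 1 else 0)" for C
    by (simp add: N_def vec_eq_iff)
  ultimately show ?thesis
    by (simp only: det_unit_rows_outside_pair[OF ij])
qed

theorem theorem1:
  fixes G H :: "('n::finite) pair_pre_digraph" and \<phi> :: "'n \<Rightarrow> 'n"
  assumes "pair_graph G" and "pair_graph H"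
    and "pverts G = UNIV" and "pverts H = UNIV"
    and "bij \<phi>"
  shows "(graph_isomorphism \<phi> G H \<longleftrightarrow>
           (\<forall>x y :: real^'n. (\<forall>i. y $ \<phi> i = x $ i) \<longrightarrow>
              det (adjacency_matrix G + diag x) = det (adjacency_matrix H + diag y)))
         \<and> (graph_isomorphism \<phi> G H \<longrightarrow> digraph_iso (with_proj G) (with_proj H))"
proof -
  interpret G: pair_graph G by fact
  interpret H: pair_graph H by fact
  have no_loops: "(k, k) \<notin> parcs G" "(k, k) \<notin> parcs H" for k
    using G.pair_no_loops[of "(k, k)"] H.pair_no_loops[of "(k, k)"] by auto
  have inj: "inj \<phi>" using assms(5) by (rule bij_is_inj)
  \<comment> \<open>The adjacency matrix of \<open>H\<close> pulled back along
    \<open>\<phi>\<close>: both determinants then carry the same \<open>x\<close>, and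
    \<open>\<phi>\<close> is an isomorphism exactly when this matrix is that of
    \<open>G\<close>.\<close>
  define B :: "real^'n^'n" where "B = (\<chi> i j. adjacency_matrix H $ \<phi> i $ \<phi> j)"
  have det_H: "det (adjacency_matrix H + diag y) = det (B + diag x)"
    if "\<forall>i. y $ \<phi> i = x $ i" for x y :: "real^'n"
  proof -
    have "(\<chi> i j. (adjacency_matrix H + diag y) $ \<phi> i $ \<phi> j) = B + diag x"
      using that by (simp add: B_def diag_def vec_eq_iff inj_eq[OF inj])
    then show ?thesis
      using det_permute_rows_columns[OF assms(5), of "adjacency_matrix H + diag y"] by simp
  qed
  have iso_iff: "graph_isomorphism \<phi> G H \<longleftrightarrow> adjacency_matrix G = B"
    using assms(3-5)
    by (auto simp: graph_isomorphism_def B_def adjacency_matrix_def vec_eq_iff)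
  have "adjacency_matrix G = B"
    if eq: "\<forall>x y :: real^'n. (\<forall>i. y $ \<phi> i = x $ i) \<longrightarrow>
      det (adjacency_matrix G + diag x) = det (adjacency_matrix H + diag y)"
  proof -
    have det_eq: "det (adjacency_matrix G + diag x) = det (B + diag x)" for x
    proof -
      \<comment> \<open>The vector \<open>y\<close> attached to a given \<open>x\<close> is
        \<open>x\<close> composed with the inverse of \<open>\<phi>\<close>.\<close>
      have y: "\<forall>i. (\<chi> k. x $ inv \<phi> k) $ \<phi> i = x $ i"
        by (simp add: inv_f_f[OF inj])
      then show ?thesis using eq det_H[OF y] by metis
    qed
    have "adjacency_matrix G $ i $ j = B $ i $ j" for i j
    proof (cases "i = j")
      case True
      then show ?thesis
        by (simp add: no_loops B_def adjacency_matrix_def)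
    next
      case False
      \<comment> \<open>With zero diagonal and symmetry the minor is minus the square of the entry,
        and the square determines an entry that is 0 or 1.\<close>
      show ?thesis
        using principal_minor_eq_if_det_add_diag_eq[OF det_eq False]
          G.arcs_symmetric[of i j] G.arcs_symmetric[of j i]
          H.arcs_symmetric[of "\<phi> i" "\<phi> j"] H.arcs_symmetric[of "\<phi> j" "\<phi> i"]
        by (auto simp: no_loops B_def adjacency_matrix_def split: if_splits)
    qed
    then show ?thesis by (simp add: vec_eq_iff)
  qed
  moreover have "digraph_iso (with_proj G) (with_proj H)" if "graph_isomorphism \<phi> G H"
    using that digraph_iso_iff_graph_isomorphism[OF assms(1,2)] by blast
  \<comment> \<open>The forward direction is \<open>det_H\<close> with \<open>B\<close> replaced by
    \<open>adjacency_matrix G\<close>.\<close>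
  ultimately show ?thesis
    unfolding iso_iff using det_H by metis
qed

end
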